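(* Let $K=2$ and let $q_{10},q_{01}\in[0,1]$ be the noise parameters of the noisy Boolean multi-access channel. For $p\in[0,1]$ put $$p_1=(1-(1-p)^2)(1-q_{01})+(1-p)^2q_{10},\qquad p_0=1-p_1,$$ and for $\lambda\in\mathbb{R}$ put $$\rho_{+}=\rho_+(\lambda,p)=\tfrac12\Big(p+(1-p)e^{\lambda}+\sqrt{(p-(1-p)e^{\lambda})^2+4p(1-p)}\Big).$$ Define $$\varphi_1=\sup_{\lambda\in\mathbb{R}}\Big(\lambda\,\frac{(1-p)^2q_{10}}{p_1}-\log\rho_+\Big),\qquad \varphi_0=\sup_{\lambda\in\mathbb{R}}\Big(\lambda\,\frac{(1-p)^2(1-q_{10})}{p_0}-\log\rho_+\Big),$$ $$C(p,q_{10},q_{01})=p_1\varphi_1+p_0\varphi_0,\qquad C_1=\frac{1}{\max_{p}C(p,q_{10},q_{01})}$$ (with $p_w\varphi_w:=0$ if $p_w=0$, and $C_1=\infty$ if the maximum is $0$, in which case the assertion is void). Let the entries of the transmission matrix be i.i.d. Bernoulli with success probability $p$ equal to a maximizer of $C(\cdot,q_{10},q_{01})$. Then for every constant $\xi>0$: if the number of rounds $T=T(N)$ satisfies $\frac{T}{\log N}\ge C_1+\xi$, then the average error probability satisfies $P_e^{(N)}\to 0$ as $N\to\infty$.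
   Context: Logarithms are natural. Partition problem ($K=2$): there are $N$ users $\{1,\dots,N\}$; the set of active users is described by $\mathbf{s}\in\{0,1\}^N$ with $\sum_i s_i=K=2$ ($s_i=1$ iff user $i$ is active), and $\mathbf{s}$ is uniformly distributed over the $\binom N2$ such vectors. A partition is a vector $\mathbf{z}\in\{1,2\}^N$ in which each of the values $1,2$ occurs. The distortion $d(\mathbf{s},\mathbf{z})$ is $0$ if $z_i\ne z_j$ for all $i<j$ with $s_i=s_j=1$, and $1$ otherwise. Channel: given an $N\times T$ matrix $\mathbf{X}=[x_{i,t}]$ with entries in $\{0,1\}$, the noiseless output at round $t$ is $y_{0,t}=\bigvee_{i:\,s_i=1}x_{i,t}$, and the vector of these is denoted $\mathbf{X}^\top\otimes\mathbf{s}$. The observed output $\mathbf{y}=(y_1,\dots,y_T)\in\{0,1\}^T$ is obtained from it by a memoryless stationary noise: independently over $t$, $\Pr(y_t=1\mid y_{0,t}=0)=q_{10}$ and $\Pr(y_t=0\mid y_{0,t}=1)=q_{01}$. Write $p(\mathbf{y}\mid\mathbf{X}^\top\otimes\mathbf{s})$ for the resulting conditional probability. Random coding and decoding: the entries $x_{i,t}$ are i.i.d. with $\Pr(x_{i,t}=1)=p$, independent of $\mathbf{s}$. The decoder $g(\mathbf{X},\mathbf{y})$ is the optimal Bayesian one: it outputs a partition $\mathbf{z}$ maximizing $\sum_{\mathbf{s}}\mathbf{1}(d(\mathbf{s},\mathbf{z})=0)\,p(\mathbf{y}\mid\mathbf{X}^\top\otimes\mathbf{s})$ (sum over all $\mathbf{s}\in\{0,1\}^N$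 with two ones; ties broken arbitrarily). The average error probability is $P_e^{(N)}=\Pr\big(d(\mathbf{s},g(\mathbf{X},\mathbf{y}))\neq 0\big)$, the probability being over $\mathbf{X}$, $\mathbf{s}$ and the channel noise. *)

theory Defs
  imports "HOL-Probability.Probability" "HOL-Probability.Product_PMF"
begin

text \<open>
  Bits are of type \<^typ>\<open>bool\<close>.  Vectors indexed by \<open>1..n\<close> and matrices are functions that
  are \<^const>\<open>False\<close> outside their index set, in accordance with the default value passed to
  \<^const>\<open>Pi_pmf\<close>.
\<close>

definition bit_vectors :: "nat \<Rightarrow> (nat \<Rightarrow> bool) set" where
  "bit_vectors n = PiE_dflt {1..n} False (\<lambda>_. UNIV)"

definition bit_matrices :: "nat \<Rightarrow> nat \<Rightarrow> (nat \<times> nat \<Rightarrow> bool) set" where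
  "bit_matrices N T = PiE_dflt ({1..N} \<times> {1..T}) False (\<lambda>_. UNIV)"

definition active_vectors :: "nat \<Rightarrow> (nat \<Rightarrow> bool) set" where
  "active_vectors N = {s \<in> bit_vectors N. (\<Sum>i=1..N. of_bool (s i)) = (2::nat)}"

definition partitions :: "nat \<Rightarrow> (nat \<Rightarrow> nat) set" where
  "partitions N = {z \<in> {1..N} \<rightarrow>\<^sub>E {1, 2}. z ` {1..N} = {1, 2}}"

definition distortion :: "nat \<Rightarrow> (nat \<Rightarrow> bool) \<Rightarrow> (nat \<Rightarrow> nat) \<Rightarrow> nat" where
  "distortion N s z =
     (if \<forall>i\<in>{1..N}. \<forall>j\<in>{1..N}. i < j \<and> s i \<and> s j \<longrightarrow> z i \<noteq> z j then 0 else 1)"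

definition noiseless_output ::
    "nat \<Rightarrow> (nat \<times> nat \<Rightarrow> bool) \<Rightarrow> (nat \<Rightarrow> bool) \<Rightarrow> nat \<Rightarrow> bool" where
  "noiseless_output N X s t \<longleftrightarrow> (\<exists>i\<in>{1..N}. s i \<and> X (i, t))"

definition noise_pmf :: "nat \<Rightarrow> real \<Rightarrow> real \<Rightarrow> (nat \<Rightarrow> bool) \<Rightarrow> (nat \<Rightarrow> bool) pmf" where
  "noise_pmf T q10 q01 y0 =
     Pi_pmf {1..T} False (\<lambda>t. bernoulli_pmf (if y0 t then 1 - q01 else q10))"

definition matrix_pmf :: "nat \<Rightarrow> nat \<Rightarrow> real \<Rightarrow> (nat \<times> nat \<Rightarrow> bool) pmf" where
  "matrix_pmf N T p = Pi_pmf ({1..N} \<times> {1..T}) False (\<lambda>_. bernoulli_pmf p)"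

text \<open>The joint law of \<open>(X, s, y)\<close>; meaningful for \<open>N \<ge> 2\<close>, when \<open>active_vectors N\<close> is nonempty.\<close>

definition system_pmf ::
    "nat \<Rightarrow> nat \<Rightarrow> real \<Rightarrow> real \<Rightarrow> real
      \<Rightarrow> ((nat \<times> nat \<Rightarrow> bool) \<times> (nat \<Rightarrow> bool) \<times> (nat \<Rightarrow> bool)) pmf" where
  "system_pmf N T p q10 q01 =
     bind_pmf (matrix_pmf N T p) (\<lambda>X.
     bind_pmf (pmf_of_set (active_vectors N)) (\<lambda>s.
     bind_pmf (noise_pmf T q10 q01 (noiseless_output N X s)) (\<lambda>y.
     return_pmf (X, s, y))))"

definition bayes_score ::
    "nat \<Rightarrow> nat \<Rightarrow> real \<Rightarrow> real \<Rightarrow> (nat \<times> nat \<Rightarrow> bool) \<Rightarrow> (nat \<Rightarrow> bool) \<Rightarrow> (nat \<Rightarrow> nat) \<Rightarrow> real" where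
  "bayes_score N T q10 q01 X y z =
     (\<Sum>s\<in>active_vectors N. of_bool (distortion N s z = 0)
        * pmf (noise_pmf T q10 q01 (noiseless_output N X s)) y)"

text \<open>Any function selecting a maximizer is admitted, whichever way it breaks ties.\<close>

definition bayes_decoder ::
    "nat \<Rightarrow> nat \<Rightarrow> real \<Rightarrow> real \<Rightarrow> ((nat \<times> nat \<Rightarrow> bool) \<Rightarrow> (nat \<Rightarrow> bool) \<Rightarrow> (nat \<Rightarrow> nat)) \<Rightarrow> bool" where
  "bayes_decoder N T q10 q01 g \<longleftrightarrow>
     (\<forall>X\<in>bit_matrices N T. \<forall>y\<in>bit_vectors T.
        g X y \<in> partitions N \<and>
        (\<forall>z\<in>partitions N. bayes_score N T q10 q01 X y z \<le> bayes_score N T q10 q01 X y (g X y)))"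

definition avg_error_prob ::
    "nat \<Rightarrow> nat \<Rightarrow> real \<Rightarrow> real \<Rightarrow> real \<Rightarrow> ((nat \<times> nat \<Rightarrow> bool) \<Rightarrow> (nat \<Rightarrow> bool) \<Rightarrow> (nat \<Rightarrow> nat)) \<Rightarrow> real" where
  "avg_error_prob N T p q10 q01 g =
     measure_pmf.prob (system_pmf N T p q10 q01) {(X, s, y). distortion N s (g X y) \<noteq> 0}"

definition prob1 :: "real \<Rightarrow> real \<Rightarrow> real \<Rightarrow> real" where
  "prob1 p q10 q01 = (1 - (1 - p)\<^sup>2) * (1 - q01) + (1 - p)\<^sup>2 * q10"

definition prob0 :: "real \<Rightarrow> real \<Rightarrow> real \<Rightarrow> real" where
  "prob0 p q10 q01 = 1 - prob1 p q10 q01"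

definition rho_plus :: "real \<Rightarrow> real \<Rightarrow> real" where
  "rho_plus l p =
     (p + (1 - p) * exp l + sqrt ((p - (1 - p) * exp l)\<^sup>2 + 4 * p * (1 - p))) / 2"

text \<open>
  The suprema below are over sets that are bounded above whenever the weight \<open>prob1\<close> resp.
  \<open>prob0\<close> is positive, see \<open>bdd_above_exponent\<close>; for \<open>p = 0\<close> the quotient is \<open>1\<close> and for \<open>p = 1\<close>
  it is \<open>0\<close>, and the functions of \<open>\<lambda>\<close> are then identically \<open>0\<close>.  If a weight is \<open>0\<close>, the
  corresponding term of \<open>cut_rate\<close> is \<open>0\<close> whatever the value of the supremum.
\<close>

definition phi1 :: "real \<Rightarrow> real \<Rightarrow> real \<Rightarrow> real" where
  "phi1 p q10 q01 = (SUP l. l * ((1 - p)\<^sup>2 * q10 / prob1 p q10 q01) - ln (rho_plus l p))"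

definition phi0 :: "real \<Rightarrow> real \<Rightarrow> real \<Rightarrow> real" where
  "phi0 p q10 q01 = (SUP l. l * ((1 - p)\<^sup>2 * (1 - q10) / prob0 p q10 q01) - ln (rho_plus l p))"

definition cut_rate :: "real \<Rightarrow> real \<Rightarrow> real \<Rightarrow> real" where
  "cut_rate p q10 q01 = prob1 p q10 q01 * phi1 p q10 q01 + prob0 p q10 q01 * phi0 p q10 q01"

text \<open>In \<^typ>\<open>ereal\<close> one has \<open>1 / 0 = \<infinity>\<close>.\<close>

definition C1 :: "real \<Rightarrow> real \<Rightarrow> ereal" where
  "C1 q10 q01 = 1 / ereal (SUP p\<in>{0..1}. cut_rate p q10 q01)"

lemma bdd_above_exponent:
  assumes "0 < p" "p < 1" "0 \<le> a" "a \<le> 1"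
  shows "bdd_above (range (\<lambda>l. l * a - ln (rho_plus l p)))"
proof (rule bdd_aboveI)
  fix x assume "x \<in> range (\<lambda>l. l * a - ln (rho_plus l p))"
  then obtain l where x: "x = l * a - ln (rho_plus l p)" by blast
  define u where "u = (1 - p) * exp l"
  have "\<bar>p - u\<bar> \<le> sqrt ((p - u)\<^sup>2 + 4 * p * (1 - p))"
    using assms by (intro real_le_rsqrt) simp
  moreover have "rho_plus l p = (p + u + sqrt ((p - u)\<^sup>2 + 4 * p * (1 - p))) / 2"
    by (simp only: rho_plus_def u_def)
  ultimately have ge: "p \<le> rho_plus l p" "(1 - p) * exp l \<le> rho_plus l p"
    unfolding u_def[symmetric] by (simp_all only: abs_le_iff le_divide_eq_numeral1) argo+
  have "ln p \<le> ln (rho_plus l p)" "ln ((1 - p) * exp l) \<le> ln (rho_plus l p)"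
    using ge assms by (auto intro!: ln_mono)
  moreover have "ln ((1 - p) * exp l) = ln (1 - p) + l"
    using assms by (simp add: ln_mult)
  moreover have "ln p \<le> 0" "ln (1 - p) \<le> 0" using assms by auto
  moreover have "l * a \<le> max 0 l"
    using assms by (cases "0 \<le> l") (auto simp: mult_left_le mult_nonpos_nonneg)
  ultimately show "x \<le> - ln p - ln (1 - p)"
    unfolding x by (auto simp: max_def split: if_splits)
qed

end

theory Submission
  imports Defs
begin

text \<open>
  Call a pair of users \<open>(i, j)\<close> accepted if the likelihood ratio of the output given both of their
  codewords against the output given the codeword of \<open>i\<close> alone is at least \<open>exp (\<theta> T)\<close>.
  If \<open>\<theta>\<close> is below the information \<open>I(X\<^sub>2; Y | X\<^sub>1)\<close>, the active pair is accepted except with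
  exponentially small probability (Chernoff), whereas an active user is accepted together with a
  given inactive one with probability at most \<open>exp (- \<theta> T)\<close>, since the
  inactive codeword is independent of the output and the likelihood ratio then has mean at most
  \<open>1\<close> (Markov).  With probability at least \<open>1 - o(1) - 2 N exp (- \<theta> T)\<close> the active pair is
  therefore an isolated edge of the graph of accepted pairs, and a partition separating the two
  ends of every such edge is correct; the Bayesian decoder does at least as well.

  Finally \<open>cut_rate p\<close> is at most \<open>I(X\<^sub>2; Y | X\<^sub>1)\<close> by the Donsker--Varadhan inequality for the
  tilted kernel whose Perron eigenvalue is \<open>rho_plus\<close>, so \<open>\<theta>\<close> can be chosen with
  \<open>\<theta> (1 / cut_rate p + \<xi>) > 1\<close>, which makes \<open>N exp (- \<theta> T)\<close> vanish.
\<close>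

subsection \<open>Expectations of products over the coordinates of a random matrix\<close>

lemma nn_integral_pmf_finite_type:
  fixes M :: "'a::finite pmf"
  assumes "\<And>v. f v \<ge> 0"
  shows "(\<integral>\<^sup>+v. ennreal (f v) \<partial>measure_pmf M) = ennreal (\<Sum>v\<in>UNIV. pmf M v * f v)"
  using assms
  by (simp add: nn_integral_measure_pmf nn_integral_count_space_finite
       ennreal_mult'[symmetric] mult.commute sum_nonneg)

lemma nn_integral_Pi_pmf_union:
  assumes "finite A" "finite B" "A \<inter> B = {}"
  shows "(\<integral>\<^sup>+f. G f \<partial>Pi_pmf (A \<union> B) d q)
    = (\<integral>\<^sup>+f. \<integral>\<^sup>+g. G (\<lambda>x. if x \<in> A then f x else g x) \<partial>Pi_pmf B d q \<partial>Pi_pmf A d q)"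
  by (subst Pi_pmf_union[OF assms]) (simp add: nn_integral_pair_pmf')

lemma nn_integral_Pi_pmf_prod_fresh:
  assumes S: "finite S" and h: "inj_on h A" "h ` A \<subseteq> S"
    and F: "\<And>x f f' v. x \<in> A \<Longrightarrow> (\<And>z. z \<notin> h ` A \<Longrightarrow> f z = f' z) \<Longrightarrow> F x f v = F x f' v"
  shows "(\<integral>\<^sup>+f. (\<Prod>x\<in>A. F x f (f (h x))) \<partial>Pi_pmf S d q)
    = (\<integral>\<^sup>+f. (\<Prod>x\<in>A. \<integral>\<^sup>+v. F x f v \<partial>q (h x)) \<partial>Pi_pmf S d q)"
proof -
  define B where "B = h ` A"
  define R where "R = S - B"
  have fin: "finite R" "finite B" and dis: "R \<inter> B = {}" and un: "S = R \<union> B"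
    using S h finite_subset by (auto simp: B_def R_def)
  have R: "h x \<notin> R" if "x \<in> A" for x
    using that by (simp add: R_def B_def)
  let ?h = "the_inv_into A h"
  have inv: "?h (h x) = x" if "x \<in> A" for x
    using h(1) that by (rule the_inv_into_f_f)
  have indep: "F x (\<lambda>z. if z \<in> R then f z else g z) v = F x (\<lambda>z. if z \<in> R then f z else d) v"
    if "x \<in> A" "g \<in> set_pmf (Pi_pmf B d q)" for x f g v
  proof (rule F[OF that(1)])
    fix z assume "z \<notin> h ` A"
    moreover from this have "g z = d"
      using that(2) set_Pi_pmf_subset[OF fin(2), of d q] by (auto simp: B_def)
    ultimately show "(if z \<in> R then f z else g z) = (if z \<in> R then f z else d)"
      by auto
  qed
  \<comment> \<open>The factors do not look at the fresh coordinates of their second argument, so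
    the default \<open>d\<close> may stand there.\<close>
  let ?F = "\<lambda>f. \<lambda>z. if z \<in> R then f z else d"
  have "(\<integral>\<^sup>+f. (\<Prod>x\<in>A. F x f (f (h x))) \<partial>Pi_pmf S d q)
    = (\<integral>\<^sup>+f. \<integral>\<^sup>+g. (\<Prod>x\<in>A. F x (\<lambda>z. if z \<in> R then f z else g z) (g (h x)))
          \<partial>Pi_pmf B d q \<partial>Pi_pmf R d q)"
    by (subst un, subst nn_integral_Pi_pmf_union[OF fin dis])
       (auto intro!: nn_integral_cong prod.cong simp: R)
  also have "\<dots> = (\<integral>\<^sup>+f. \<integral>\<^sup>+g. (\<Prod>b\<in>B. F (?h b) (?F f) (g b))
          \<partial>Pi_pmf B d q \<partial>Pi_pmf R d q)"
    unfolding B_def[symmetric]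
    by (intro nn_integral_cong nn_integral_cong_AE)
       (auto simp: AE_measure_pmf_iff indep prod.reindex[OF h(1), folded B_def] inv intro!: prod.cong)
  also have "\<dots> = (\<integral>\<^sup>+f. (\<Prod>b\<in>B. \<integral>\<^sup>+v. F (?h b) (?F f) v \<partial>q b) \<partial>Pi_pmf R d q)"
    by (intro nn_integral_cong nn_integral_prod_Pi_pmf fin)
  also have "\<dots> = (\<integral>\<^sup>+f. (\<Prod>x\<in>A. \<integral>\<^sup>+v. F x (?F f) v \<partial>q (h x)) \<partial>Pi_pmf R d q)"
    by (auto simp: B_def prod.reindex[OF h(1)] inv intro!: nn_integral_cong prod.cong)
  \<comment> \<open>For the same reason the fresh coordinates can be put back. The result is again
    an integral over the full index set, so the lemma can be applied to a further row.\<close>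
  also have "\<dots> = (\<integral>\<^sup>+f. \<integral>\<^sup>+g. (\<Prod>x\<in>A. \<integral>\<^sup>+v. F x (\<lambda>z. if z \<in> R then f z else g z) v \<partial>q (h x))
          \<partial>Pi_pmf B d q \<partial>Pi_pmf R d q)"
  proof (rule nn_integral_cong)
    fix f
    have "(\<integral>\<^sup>+g. (\<Prod>x\<in>A. \<integral>\<^sup>+v. F x (\<lambda>z. if z \<in> R then f z else g z) v \<partial>q (h x)) \<partial>Pi_pmf B d q)
      = (\<integral>\<^sup>+g. (\<Prod>x\<in>A. \<integral>\<^sup>+v. F x (?F f) v \<partial>q (h x)) \<partial>Pi_pmf B d q)"
      by (intro nn_integral_cong_AE)
         (auto simp: AE_measure_pmf_iff indep intro!: prod.cong nn_integral_cong)
    then show "(\<Prod>x\<in>A. \<integral>\<^sup>+v. F x (?F f) v \<partial>q (h x))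
        = (\<integral>\<^sup>+g. (\<Prod>x\<in>A. \<integral>\<^sup>+v. F x (\<lambda>z. if z \<in> R then f z else g z) v \<partial>q (h x)) \<partial>Pi_pmf B d q)"
      by simp
  qed
  also have "\<dots> = (\<integral>\<^sup>+f. (\<Prod>x\<in>A. \<integral>\<^sup>+v. F x f v \<partial>q (h x)) \<partial>Pi_pmf S d q)"
    by (subst un, subst nn_integral_Pi_pmf_union[OF fin dis]) (rule refl)
  finally show ?thesis .
qed

text \<open>Row \<open>b\<close> is integrated out with row \<open>a\<close> frozen, then row
  \<open>a\<close>. All rounds contribute the same factor, hence the power \<open>T\<close>.\<close>

lemma nn_integral_matrix_two_rows:
  assumes "a \<in> {1..N}" "b \<in> {1..N}" "a \<noteq> b" and F: "\<And>u v. F u v \<ge> 0"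
  shows "(\<integral>\<^sup>+X. (\<Prod>t\<in>{1..T}. ennreal (F (X (a, t)) (X (b, t)))) \<partial>matrix_pmf N T p)
    = ennreal (\<Sum>u\<in>UNIV. \<Sum>v\<in>UNIV. pmf (bernoulli_pmf p) u * pmf (bernoulli_pmf p) v * F u v) ^ T"
proof -
  let ?P = "pmf (bernoulli_pmf p)"
  let ?G = "\<lambda>u. \<Sum>v\<in>UNIV. ?P v * F u v"
  have G: "?G u \<ge> 0" for u
    using F by (intro sum_nonneg) simp
  have "(\<integral>\<^sup>+X. (\<Prod>t\<in>{1..T}. ennreal (F (X (a, t)) (X (b, t)))) \<partial>matrix_pmf N T p)
     = (\<integral>\<^sup>+X. (\<Prod>t\<in>{1..T}. \<integral>\<^sup>+v. ennreal (F (X (a, t)) v) \<partial>bernoulli_pmf p) \<partial>matrix_pmf N T p)"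
    unfolding matrix_pmf_def
    by (rule nn_integral_Pi_pmf_prod_fresh[where h = "\<lambda>t. (b, t)" and F = "\<lambda>t X v. ennreal (F (X (a, t)) v)"])
       (use assms in \<open>auto simp: inj_on_def image_iff\<close>)
  also have "\<dots> = (\<integral>\<^sup>+X. (\<Prod>t\<in>{1..T}. ennreal (?G (X (a, t)))) \<partial>matrix_pmf N T p)"
    by (simp add: nn_integral_pmf_finite_type F)
  also have "\<dots> = (\<integral>\<^sup>+X. (\<Prod>t\<in>{1..T}. \<integral>\<^sup>+u. ennreal (?G u) \<partial>bernoulli_pmf p) \<partial>matrix_pmf N T p)"
    unfolding matrix_pmf_def
    by (rule nn_integral_Pi_pmf_prod_fresh[where h = "\<lambda>t. (a, t)" and F = "\<lambda>t X v. ennreal (?G v)"])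
       (use assms in \<open>auto simp: inj_on_def image_iff\<close>)
  also have "\<dots> = ennreal (\<Sum>u\<in>UNIV. ?P u * ?G u) ^ T"
    by (simp add: nn_integral_pmf_finite_type[OF G])
  finally show ?thesis
    by (simp add: sum_distrib_left mult.assoc)
qed

lemma nn_integral_matrix_three_rows:
  assumes "a \<in> {1..N}" "b \<in> {1..N}" "k \<in> {1..N}" "a \<noteq> b" "k \<noteq> a" "k \<noteq> b"
    and F: "\<And>u v x. F u v x \<ge> 0"
  shows "(\<integral>\<^sup>+X. (\<Prod>t\<in>{1..T}. ennreal (F (X (a, t)) (X (b, t)) (X (k, t)))) \<partial>matrix_pmf N T p)
    = ennreal (\<Sum>u\<in>UNIV. \<Sum>v\<in>UNIV. pmf (bernoulli_pmf p) u * pmf (bernoulli_pmf p) v *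
        (\<Sum>x\<in>UNIV. pmf (bernoulli_pmf p) x * F u v x)) ^ T"
proof -
  have "(\<integral>\<^sup>+X. (\<Prod>t\<in>{1..T}. ennreal (F (X (a, t)) (X (b, t)) (X (k, t)))) \<partial>matrix_pmf N T p)
     = (\<integral>\<^sup>+X. (\<Prod>t\<in>{1..T}. \<integral>\<^sup>+v. ennreal (F (X (a, t)) (X (b, t)) v) \<partial>bernoulli_pmf p) \<partial>matrix_pmf N T p)"
    unfolding matrix_pmf_def
    by (rule nn_integral_Pi_pmf_prod_fresh[where h = "\<lambda>t. (k, t)"
          and F = "\<lambda>t X v. ennreal (F (X (a, t)) (X (b, t)) v)"])
       (use assms in \<open>auto simp: inj_on_def image_iff\<close>)
  then show ?thesis
    by (simp only: nn_integral_pmf_finite_type[OF F]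
        nn_integral_matrix_two_rows[OF assms(1,2,4), where F = "\<lambda>u v. \<Sum>x\<in>UNIV. pmf (bernoulli_pmf p) x * F u v x",
          OF sum_nonneg[OF mult_nonneg_nonneg[OF pmf_nonneg F]]])
qed

lemma nn_integral_noise:
  fixes F :: "nat \<Rightarrow> bool \<Rightarrow> real"
  assumes "\<And>t w. F t w \<ge> 0"
  shows "(\<integral>\<^sup>+y. (\<Prod>t\<in>{1..T}. ennreal (F t (y t))) \<partial>noise_pmf T q10 q01 y0)
    = (\<Prod>t\<in>{1..T}. ennreal (\<Sum>w\<in>UNIV. pmf (bernoulli_pmf (if y0 t then 1 - q01 else q10)) w * F t w))"
  unfolding noise_pmf_def
  by (subst nn_integral_prod_Pi_pmf[where f = "\<lambda>t w. ennreal (F t w)"])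
     (auto simp: nn_integral_pmf_finite_type assms)

subsection \<open>Optimality of the Bayesian decoder\<close>

lemma finite_bit_vectors: "finite (bit_vectors n)"
  unfolding bit_vectors_def by (intro finite_PiE_dflt) auto

lemma finite_bit_matrices: "finite (bit_matrices N T)"
  unfolding bit_matrices_def by (intro finite_PiE_dflt) auto

lemma finite_active_vectors: "finite (active_vectors N)"
  unfolding active_vectors_def using finite_bit_vectors by simp

lemma set_noise_pmf: "set_pmf (noise_pmf T q10 q01 y0) \<subseteq> bit_vectors T"
  unfolding noise_pmf_def bit_vectors_def
  using set_Pi_pmf_subset'[of "{1..T}"] by (fastforce simp: PiE_dflt_def)

lemma set_matrix_pmf: "set_pmf (matrix_pmf N T p) \<subseteq> bit_matrices N T"
  unfolding matrix_pmf_def bit_matrices_def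
  using set_Pi_pmf_subset'[of "{1..N} \<times> {1..T}"] by (fastforce simp: PiE_dflt_def)

lemma active_vector_pair:
  assumes "a \<in> {1..N}" "b \<in> {1..N}" "a < b"
  shows "(\<lambda>i. i = a \<or> i = b) \<in> active_vectors N"
proof -
  have "(\<Sum>i=1..N. of_bool (i = a \<or> i = b)) = (\<Sum>i\<in>{a, b}. 1::nat)"
    using assms by (intro sum.mono_neutral_cong_right) auto
  then show ?thesis
    using assms unfolding active_vectors_def bit_vectors_def PiE_dflt_def
    by (auto simp del: of_bool_or_iff sum_of_bool_eq)
qed

lemma active_vectorE:
  assumes "s \<in> active_vectors N"
  obtains a b where "a \<in> {1..N}" "b \<in> {1..N}" "a < b" "s = (\<lambda>i. i = a \<or> i = b)"
proof -
  have out: "\<not> s i" if "i \<notin> {1..N}" for i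
    using assms that by (auto simp: active_vectors_def bit_vectors_def PiE_dflt_def)
  have "card {i \<in> {1..N}. s i} = 2"
    using assms by (simp add: active_vectors_def sum.If_cases of_bool_def Int_def)
  then obtain x y where xy: "{i \<in> {1..N}. s i} = {x, y}" "x \<noteq> y"
    by (auto simp: card_2_iff)
  have "s i \<longleftrightarrow> i = x \<or> i = y" for i
    using xy(1) out by blast
  moreover have "x \<in> {1..N}" "y \<in> {1..N}"
    using xy(1) by blast+
  ultimately show thesis
    using that[of x y] that[of y x] xy(2) by (cases x y rule: linorder_cases) (auto simp: fun_eq_iff)
qed

lemma active_vectors_nonempty: "N \<ge> 2 \<Longrightarrow> active_vectors N \<noteq> {}"
  using active_vector_pair[of 1 N 2] by auto

lemma distortion_pair:
  assumes "a \<in> {1..N}" "b \<in> {1..N}" "a < b" "z a \<noteq> z b"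
  shows "distortion N (\<lambda>i. i = a \<or> i = b) z = 0"
  using assms by (auto simp: distortion_def)

lemma noiseless_output_pair:
  assumes "a \<in> {1..N}" "b \<in> {1..N}"
  shows "noiseless_output N X (\<lambda>i. i = a \<or> i = b) = (\<lambda>t. X (a, t) \<or> X (b, t))"
  using assms by (auto simp: noiseless_output_def fun_eq_iff)

section \<open>The error probability as an average of Bayes scores\<close>

lemma emeasure_system_pmf:
  "emeasure (system_pmf N T p q10 q01) A =
    (\<integral>\<^sup>+X. \<integral>\<^sup>+s. \<integral>\<^sup>+y. indicator A (X, s, y) \<partial>noise_pmf T q10 q01 (noiseless_output N X s)
      \<partial>pmf_of_set (active_vectors N) \<partial>matrix_pmf N T p)"
  unfolding system_pmf_def emeasure_bind_pmf
  by (simp add: nn_integral_indicator[symmetric] flip: measure_pmf.emeasure_eq_measure)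

text \<open>For fixed \<open>X\<close> the success probability is a double sum over \<open>s\<close>
  and \<open>y\<close>. Since \<open>s\<close> is uniform, exchanging the sums leaves the Bayes
  score of the chosen partition at each \<open>y\<close>. Decoders can thus be compared pointwise in
  \<open>X\<close> and \<open>y\<close>.\<close>

lemma avg_error_prob_bayes_score:
  assumes "N \<ge> 2"
  shows "avg_error_prob N T p q10 q01 g = 1 - (\<Sum>X\<in>bit_matrices N T. pmf (matrix_pmf N T p) X *
     ((\<Sum>y\<in>bit_vectors T. bayes_score N T q10 q01 X y (g X y)) / card (active_vectors N)))"
proof -
  let ?S = "active_vectors N" and ?M = "system_pmf N T p q10 q01"
  let ?W = "\<lambda>X s. noise_pmf T q10 q01 (noiseless_output N X s)"
  let ?ok = "{(X, s, y). distortion N s (g X y) = 0}"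
  let ?c = "\<lambda>X. (\<Sum>s\<in>?S. measure_pmf.prob (?W X s) {y. distortion N s (g X y) = 0}) / card ?S"
  note S = active_vectors_nonempty[OF assms] finite_active_vectors
  have score: "(\<Sum>s\<in>?S. measure_pmf.prob (?W X s) {y. distortion N s (g X y) = 0})
     = (\<Sum>y\<in>bit_vectors T. bayes_score N T q10 q01 X y (g X y))" for X
  proof -
    have "measure_pmf.prob (?W X s) {y. distortion N s (g X y) = 0}
      = (\<Sum>y\<in>bit_vectors T. of_bool (distortion N s (g X y) = 0) * pmf (?W X s) y)" for s
    proof -
      have "measure_pmf.prob (?W X s) {y. distortion N s (g X y) = 0}
        = measure_pmf.prob (?W X s) {y \<in> bit_vectors T. distortion N s (g X y) = 0}"
        using set_noise_pmf[of T q10 q01 "noiseless_output N X s"]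
        by (intro measure_pmf.finite_measure_eq_AE) (auto simp: AE_measure_pmf_iff)
      also have "\<dots> = (\<Sum>y\<in>bit_vectors T. of_bool (distortion N s (g X y) = 0) * pmf (?W X s) y)"
        using finite_bit_vectors[of T]
        by (subst measure_measure_pmf_finite) (auto intro!: sum.mono_neutral_cong_left)
      finally show ?thesis .
    qed
    then show ?thesis
      unfolding bayes_score_def by (simp add: sum.swap[of _ _ ?S])
  qed
  have "avg_error_prob N T p q10 q01 g = 1 - measure_pmf.prob ?M ?ok"
    unfolding avg_error_prob_def
    by (subst measure_pmf.prob_compl[symmetric]) (auto intro!: arg_cong[where f = "measure_pmf.prob ?M"])
  also have "measure_pmf.prob ?M ?ok = (\<Sum>X\<in>bit_matrices N T. pmf (matrix_pmf N T p) X *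
     ((\<Sum>s\<in>?S. measure_pmf.prob (?W X s) {y. distortion N s (g X y) = 0}) / card ?S))"
  proof -
    have "ennreal (measure_pmf.prob ?M ?ok) = emeasure ?M ?ok"
      by (simp add: measure_pmf.emeasure_eq_measure)
    also have "\<dots> = (\<integral>\<^sup>+X. \<integral>\<^sup>+s. emeasure (?W X s) {y. distortion N s (g X y) = 0}
        \<partial>pmf_of_set ?S \<partial>matrix_pmf N T p)"
      unfolding emeasure_system_pmf by (simp add: nn_integral_indicator[symmetric] indicator_def)
    also have "\<dots> = (\<integral>\<^sup>+X. ennreal (?c X) \<partial>matrix_pmf N T p)"
      using S by (simp add: nn_integral_pmf_of_set measure_pmf.emeasure_eq_measure divide_ennreal
          sum_nonneg card_gt_0_iff ennreal_of_nat_eq_real_of_nat)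
    also have "\<dots> = (\<Sum>X\<in>bit_matrices N T. ennreal (?c X) * ennreal (pmf (matrix_pmf N T p) X))"
      using set_matrix_pmf[of N T p]
      by (intro nn_integral_measure_pmf_support finite_bit_matrices) auto
    also have "\<dots> = ennreal (\<Sum>X\<in>bit_matrices N T. pmf (matrix_pmf N T p) X * ?c X)"
      by (simp add: ennreal_mult'[symmetric] sum_nonneg mult.commute)
    finally show ?thesis
      by (subst (asm) ennreal_inj) (auto intro!: sum_nonneg divide_nonneg_nonneg mult_nonneg_nonneg)
  qed
  finally show ?thesis
    by (simp only: score)
qed

text \<open>The rival \<open>h\<close> must take values in \<open>partitions N\<close>, because the
  Bayesian decoder maximizes the score only there.\<close>

lemma bayes_decoder_optimal:
  assumes "N \<ge> 2" "bayes_decoder N T q10 q01 g"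
    and "\<And>X y. h X y \<in> partitions N"
  shows "avg_error_prob N T p q10 q01 g \<le> avg_error_prob N T p q10 q01 h"
  using assms
  by (auto simp: avg_error_prob_bayes_score bayes_decoder_def
      intro!: sum_mono mult_left_mono divide_right_mono)

subsection \<open>Information and the cut rate\<close>

text \<open>With \<open>p\<close> strictly between 0 and 1 both input bits have positive
  probability. The endpoints are excluded in the final proof because \<open>cut_rate\<close> is 0
  there.\<close>

locale boolean_mac =
  fixes p q10 q01 :: real
  assumes p: "0 < p" "p < 1" and q: "q10 \<in> {0..1}" "q01 \<in> {0..1}"
begin

definition input_prob :: "bool \<Rightarrow> real" where
  "input_prob u = pmf (bernoulli_pmf p) u"

definition channel_prob :: "bool \<Rightarrow> bool \<Rightarrow> real" where
  "channel_prob w b = pmf (bernoulli_pmf (if b then 1 - q01 else q10)) w"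

text \<open>This is the law of the output in one round given the bit \<open>u\<close> of one active
  user, the bit of the other being averaged out. Dividing by it yields the conditional information
  I(X2; Y | X1).\<close>

definition averaged_prob :: "bool \<Rightarrow> bool \<Rightarrow> real" where
  "averaged_prob w u = (\<Sum>v\<in>UNIV. input_prob v * channel_prob w (u \<or> v))"

text \<open>For outputs \<open>w\<close> that are impossible given \<open>u\<close> this is \<open>0 / 0 = 0\<close>, and in
  \<open>mutual_info\<close> the term \<open>ln 0 = 0\<close> only occurs with weight \<open>0\<close>.\<close>

definition likelihood_ratio :: "bool \<Rightarrow> bool \<Rightarrow> bool \<Rightarrow> real" where
  "likelihood_ratio u v w = channel_prob w (u \<or> v) / averaged_prob w u"

definition joint_prob :: "bool \<Rightarrow> bool \<Rightarrow> bool \<Rightarrow> real" where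
  "joint_prob u v w = input_prob u * input_prob v * channel_prob w (u \<or> v)"

definition mutual_info :: real where
  "mutual_info = (\<Sum>u\<in>UNIV. \<Sum>v\<in>UNIV. \<Sum>w\<in>UNIV. joint_prob u v w * ln (likelihood_ratio u v w))"

lemma input_prob_pos: "input_prob u > 0"
  using p by (cases u) (auto simp: input_prob_def)

lemma channel_prob_nonneg: "channel_prob w b \<ge> 0"
  by (simp add: channel_prob_def)

lemma sum_input_prob: "(\<Sum>u\<in>UNIV. input_prob u) = 1"
  using p by (simp add: input_prob_def UNIV_bool)

lemma sum_channel_prob: "(\<Sum>w\<in>UNIV. channel_prob w b) = 1"
  using q by (simp add: channel_prob_def UNIV_bool)

lemma averaged_prob_nonneg: "averaged_prob w u \<ge> 0"
  unfolding averaged_prob_def by (intro sum_nonneg) (simp add: channel_prob_nonneg less_imp_le[OF input_prob_pos])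

lemma averaged_prob_pos:
  assumes "channel_prob w (u \<or> v) > 0"
  shows "averaged_prob w u > 0"
proof -
  have "input_prob v * channel_prob w (u \<or> v) \<le> averaged_prob w u"
    unfolding averaged_prob_def by (intro member_le_sum) (auto simp: channel_prob_nonneg less_imp_le[OF input_prob_pos])
  then show ?thesis
    using assms input_prob_pos[of v] by (meson less_le_trans mult_pos_pos)
qed

lemma likelihood_ratio_nonneg: "likelihood_ratio u v w \<ge> 0"
  by (simp add: likelihood_ratio_def channel_prob_nonneg averaged_prob_nonneg)

lemma likelihood_ratio_pos: "channel_prob w (u \<or> v) > 0 \<Longrightarrow> likelihood_ratio u v w > 0"
  using averaged_prob_pos by (simp add: likelihood_ratio_def)

lemma joint_prob_nonneg: "joint_prob u v w \<ge> 0"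
  by (simp add: joint_prob_def channel_prob_nonneg less_imp_le[OF input_prob_pos])

lemma sum_joint_prob: "(\<Sum>u\<in>UNIV. \<Sum>v\<in>UNIV. \<Sum>w\<in>UNIV. joint_prob u v w) = 1"
  by (simp add: joint_prob_def sum_distrib_left[symmetric]
          sum_channel_prob sum_input_prob)

section \<open>The Perron eigenvalue and the bound on the cut rate\<close>

lemma rho_plus_gt: "rho_plus l p > p"
proof -
  define u where "u = (1 - p) * exp l"
  \<comment> \<open>Strict because \<open>4 * p * (1 - p)\<close> is positive. Strictness is what
    makes the eigenvector entry \<open>\<rho> - p\<close> positive later.\<close>
  have "\<bar>p - u\<bar> < sqrt ((p - u)\<^sup>2 + 4 * p * (1 - p))"
    using p by (intro real_less_rsqrt) simp
  moreover have "rho_plus l p = (p + u + sqrt ((p - u)\<^sup>2 + 4 * p * (1 - p))) / 2"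
    by (simp only: rho_plus_def u_def)
  ultimately show ?thesis
    by (simp add: abs_if split: if_splits)
qed

text \<open>Without tilt the kernel is stochastic. This value settles outputs of probability 0 in
  \<open>cut_rate_le_mutual_info\<close>.\<close>

lemma rho_plus_zero: "rho_plus 0 p = 1"
proof -
  have "(p - (1 - p))\<^sup>2 + 4 * p * (1 - p) = 1"
    by algebra
  then show ?thesis
    by (simp add: rho_plus_def)
qed

text \<open>This is the characteristic equation of the 2 by 2 tilted kernel, whose diagonal entries
  are \<open>p\<close> and \<open>(1 - p) * exp l\<close> and whose off-diagonal entries have
  product \<open>p * (1 - p)\<close>.\<close>

lemma rho_plus_char: "(rho_plus l p - p) * (rho_plus l p - (1 - p) * exp l) = p * (1 - p)"
proof -
  define u where "u = (1 - p) * exp l"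
  define d where "d = sqrt ((p - u)\<^sup>2 + 4 * p * (1 - p))"
  have "d\<^sup>2 = (p - u)\<^sup>2 + 4 * p * (1 - p)"
    unfolding d_def using p by simp
  moreover have "d = 2 * rho_plus l p - p - u"
    by (simp add: rho_plus_def u_def d_def field_simps)
  ultimately have "4 * ((rho_plus l p - p) * (rho_plus l p - u)) = 4 * (p * (1 - p))"
    by algebra
  then show ?thesis
    by (simp add: u_def)
qed

text \<open>\<open>rho_plus l p\<close> is the Perron eigenvalue of the kernel
  \<open>input_prob v * exp (l * of_bool (\<not> (u \<or> v)))\<close>, with eigenvector \<open>r\<close>; applying \<open>ln x \<le> x - 1\<close> to the tilted kernel gives the Donsker--Varadhan
  bound.\<close>

lemma tilted_exponent_le:
  "l * joint_prob False False w - (\<Sum>u\<in>UNIV. \<Sum>v\<in>UNIV. joint_prob u v w) * ln (rho_plus l p)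
    \<le> (\<Sum>u\<in>UNIV. \<Sum>v\<in>UNIV. joint_prob u v w * ln (likelihood_ratio u v w))"
proof -
  define \<rho> where "\<rho> = rho_plus l p"
  define r where "r u = (if u then 1 - p else \<rho> - p)" for u :: bool
  define e where "e u v = (if u \<or> v then 1 else exp l)" for u v :: bool
  have \<rho>: "\<rho> > p" "\<rho> > 0"
    using rho_plus_gt[of l] p by (auto simp: \<rho>_def)
  have r: "r u > 0" for u
    using \<rho> p by (auto simp: r_def)
  have e: "e u v > 0" for u v
    by (simp add: e_def)
  \<comment> \<open>For \<open>u = True\<close> the equation holds for any value of \<rho>; for
    \<open>u = False\<close> it is the characteristic equation.\<close>
  have eig: "(\<Sum>v\<in>UNIV. input_prob v * e u v * r v) = \<rho> * r u" for u
    using rho_plus_char[of l] p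
    by (cases u) (simp_all add: UNIV_bool input_prob_def e_def r_def \<rho>_def algebra_simps)
  \<comment> \<open>Multiplication by \<open>joint_prob\<close> cancels the likelihood ratio and
    leaves the tilted kernel. By \<open>eig\<close> the right-hand sides then add up to 0 over
    \<open>u\<close> and \<open>v\<close>.\<close>
  have le: "joint_prob u v w * (ln (e u v) + ln (r v) - ln \<rho> - ln (r u) - ln (likelihood_ratio u v w))
      \<le> input_prob u * averaged_prob w u / (\<rho> * r u) * (input_prob v * e u v * r v) - joint_prob u v w" for u v
  proof (cases "channel_prob w (u \<or> v) > 0")
    case False
    then have "joint_prob u v w = 0"
      using channel_prob_nonneg[of w "u \<or> v"] by (simp add: joint_prob_def)
    then show ?thesis
      using \<rho> r[of u] r[of v] e[of u v] input_prob_pos averaged_prob_nonneg by (simp add: less_imp_le)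
  next
    case True
    note pos = likelihood_ratio_pos[OF True] averaged_prob_pos[OF True] r[of u] r[of v] e[of u v] \<rho>(2) True
    let ?x = "e u v * r v / (\<rho> * r u * likelihood_ratio u v w)"
    have "ln (e u v) + ln (r v) - ln \<rho> - ln (r u) - ln (likelihood_ratio u v w) = ln ?x"
      using pos by (simp add: ln_mult ln_div)
    also have "\<dots> \<le> ?x - 1"
      using pos by (intro ln_le_minus_one) simp
    finally have "joint_prob u v w * (ln (e u v) + ln (r v) - ln \<rho> - ln (r u) - ln (likelihood_ratio u v w))
        \<le> joint_prob u v w * (?x - 1)"
      by (intro mult_left_mono joint_prob_nonneg)
    also have "\<dots> = input_prob u * averaged_prob w u / (\<rho> * r u) * (input_prob v * e u v * r v) - joint_prob u v w"
      using pos by (simp add: joint_prob_def likelihood_ratio_def field_simps)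
    finally show ?thesis .
  qed
  have "(\<Sum>u\<in>UNIV. \<Sum>v\<in>UNIV. joint_prob u v w * (ln (e u v) + ln (r v) - ln \<rho> - ln (r u)
        - ln (likelihood_ratio u v w)))
    \<le> (\<Sum>u\<in>UNIV. \<Sum>v\<in>UNIV. input_prob u * averaged_prob w u / (\<rho> * r u) * (input_prob v * e u v * r v)
        - joint_prob u v w)"
    by (intro sum_mono le)
  also have "\<dots> = (\<Sum>u\<in>UNIV. input_prob u * averaged_prob w u / (\<rho> * r u) * (\<rho> * r u))
      - (\<Sum>u\<in>UNIV. \<Sum>v\<in>UNIV. joint_prob u v w)"
    by (simp only: sum_subtractf sum_distrib_left[symmetric] eig)
  also have "(\<Sum>u\<in>UNIV. input_prob u * averaged_prob w u / (\<rho> * r u) * (\<rho> * r u))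
      = (\<Sum>u\<in>UNIV. input_prob u * averaged_prob w u)"
    using \<rho> by (intro sum.cong) (auto simp: less_imp_neq[OF r, symmetric])
  also have "\<dots> = (\<Sum>u\<in>UNIV. \<Sum>v\<in>UNIV. joint_prob u v w)"
    by (simp add: joint_prob_def averaged_prob_def sum_distrib_left mult.assoc)
  \<comment> \<open>As \<open>joint_prob\<close> is symmetric in \<open>u\<close> and
    \<open>v\<close>, the terms \<open>ln (r v) - ln (r u)\<close> cancel. Only
    \<open>u = v = False\<close> has \<open>e u v\<close> different from 1, which leaves the summand
    with \<open>l\<close>.\<close>
  finally show ?thesis
    unfolding \<rho>_def[symmetric] by (simp add: UNIV_bool e_def joint_prob_def algebra_simps)
qed

text \<open>For each output \<open>w\<close>, \<open>tilted_exponent_le\<close> holds for every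
  \<open>l\<close>, so it survives division by the probability of \<open>w\<close> and the supremum
  over \<open>l\<close>. The two outputs together give the whole of
  \<open>mutual_info\<close>.\<close>

lemma cut_rate_le_mutual_info: "cut_rate p q10 q01 \<le> mutual_info"
proof -
  let ?m = "\<lambda>w. \<Sum>u\<in>UNIV. \<Sum>v\<in>UNIV. joint_prob u v w"
  let ?D = "\<lambda>w. \<Sum>u\<in>UNIV. \<Sum>v\<in>UNIV. joint_prob u v w * ln (likelihood_ratio u v w)"
  have mass: "?m True = prob1 p q10 q01" "?m False = prob0 p q10 q01"
    "joint_prob False False True = (1 - p)\<^sup>2 * q10" "joint_prob False False False = (1 - p)\<^sup>2 * (1 - q10)"
    using p q
    by (simp_all add: UNIV_bool joint_prob_def input_prob_def channel_prob_def prob0_def prob1_def algebra_simps power2_eq_square)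
  have scale: "l * (J / M) - r \<le> D / M" if "M > 0" "l * J - M * r \<le> D" for l J M r D :: real
    using divide_right_mono[OF that(2), of M] that(1) by (simp add: diff_divide_distrib)
  have sup: "?m w * (SUP l. l * (joint_prob False False w / ?m w) - ln (rho_plus l p)) \<le> ?D w" for w
  proof (cases "?m w = 0")
    case True
    \<comment> \<open>The supremum may be meaningless here, but its weight is 0. The case
      \<open>l = 0\<close> shows that the right-hand side is nonnegative.\<close>
    then show ?thesis
      using tilted_exponent_le[of 0 w] by (simp only: rho_plus_zero ln_one mult_zero_left mult_zero_right diff_zero)
  next
    case False
    then have pos: "?m w > 0"
      by (simp add: order_less_le sum_nonneg joint_prob_nonneg)
    have "(SUP l. l * (joint_prob False False w / ?m w) - ln (rho_plus l p)) \<le> ?D w / ?m w"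
      by (intro cSUP_least scale pos tilted_exponent_le) simp
    then show ?thesis
      using pos by (simp only: pos_le_divide_eq mult.commute)
  qed
  have "cut_rate p q10 q01 \<le> ?D True + ?D False"
    using sup[of True] sup[of False] unfolding cut_rate_def phi1_def phi0_def mass by simp
  also have "\<dots> = mutual_info"
    by (simp add: mutual_info_def UNIV_bool)
  finally show ?thesis .
qed

section \<open>Single-round factors of the Chernoff and Markov bounds\<close>

lemma exists_chernoff_exponent:
  assumes "\<theta> < mutual_info"
  obtains \<sigma> where "\<sigma> > 0"
    "exp (\<theta> * \<sigma>) * (\<Sum>u\<in>UNIV. \<Sum>v\<in>UNIV. \<Sum>w\<in>UNIV. joint_prob u v w * likelihood_ratio u v w powr (- \<sigma>)) < 1"
proof -
  \<comment> \<open>\<open>G\<close> is the moment generating function of \<theta> minus the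
    log-likelihood ratio. It has value 1 and slope \<open>\<theta> - mutual_info < 0\<close> at 0,
    so it drops below 1 just to the right of 0.\<close>
  define G where "G \<sigma> = exp (\<theta> * \<sigma>) *
    (\<Sum>u\<in>UNIV. \<Sum>v\<in>UNIV. \<Sum>w\<in>UNIV. joint_prob u v w * exp (- \<sigma> * ln (likelihood_ratio u v w)))" for \<sigma>
  have "(G has_real_derivative \<theta> * (\<Sum>u\<in>UNIV. \<Sum>v\<in>UNIV. \<Sum>w\<in>UNIV. joint_prob u v w)
    - (\<Sum>u\<in>UNIV. \<Sum>v\<in>UNIV. \<Sum>w\<in>UNIV. joint_prob u v w * ln (likelihood_ratio u v w))) (at 0)"
    unfolding G_def by (auto intro!: derivative_eq_intros simp: sum_negf mult.commute)
  then have "(G has_real_derivative \<theta> - mutual_info) (at 0)"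
    by (simp add: sum_joint_prob mutual_info_def)
  from DERIV_neg_dec_right[OF this] assms obtain d where d: "d > 0" "\<And>h. h > 0 \<Longrightarrow> h < d \<Longrightarrow> G h < G 0"
    by auto
  have lt: "G (d / 2) < 1"
    using d(2)[of "d / 2"] d(1) by (simp add: G_def sum_joint_prob)
  \<comment> \<open>At likelihood ratio 0 the two expressions differ, since
    \<open>0 powr x = 0\<close> while \<open>ln 0 = 0\<close> gives \<open>exp 0 = 1\<close>; but
    there the weight \<open>joint_prob\<close> is 0.\<close>
  have powr: "joint_prob u v w * likelihood_ratio u v w powr (- \<sigma>)
      = joint_prob u v w * exp (- \<sigma> * ln (likelihood_ratio u v w))" for u v w \<sigma>
    using channel_prob_nonneg[of w "u \<or> v"] likelihood_ratio_pos[of w u v]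
    by (cases "channel_prob w (u \<or> v) = 0") (auto simp: joint_prob_def powr_def)
  show thesis
    by (rule that[of "d / 2"]) (use d(1) lt in \<open>simp_all only: G_def powr half_gt_zero\<close>)
qed

text \<open>Here \<open>u\<close>, \<open>v\<close> are the bits of the active users and
  \<open>x\<close> that of an inactive one. Given \<open>u\<close>, the bit \<open>x\<close> is
  independent of the output, so averaging over \<open>v\<close> and \<open>x\<close> separately
  gives \<open>averaged_prob\<close> once as the law of \<open>w\<close> and once as the numerator,
  which cancels the denominator.\<close>

lemma sum_likelihood_ratio_le:
  "(\<Sum>u\<in>UNIV. \<Sum>v\<in>UNIV. input_prob u * input_prob v * (\<Sum>x\<in>UNIV. input_prob x *
      (\<Sum>w\<in>UNIV. channel_prob w (u \<or> v) * likelihood_ratio u x w))) \<le> 1"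
proof -
  have "(\<Sum>v\<in>UNIV. input_prob v * (\<Sum>x\<in>UNIV. input_prob x *
      (\<Sum>w\<in>UNIV. channel_prob w (u \<or> v) * likelihood_ratio u x w))) \<le> 1" for u
  proof -
    have "(\<Sum>v\<in>UNIV. input_prob v * (\<Sum>x\<in>UNIV. input_prob x *
      (\<Sum>w\<in>UNIV. channel_prob w (u \<or> v) * likelihood_ratio u x w)))
      = (\<Sum>w\<in>UNIV. averaged_prob w u * (\<Sum>x\<in>UNIV. input_prob x * channel_prob w (u \<or> x)) / averaged_prob w u)"
      by (simp add: UNIV_bool likelihood_ratio_def averaged_prob_def algebra_simps add_divide_distrib)
    also have "\<dots> = (\<Sum>w\<in>UNIV. averaged_prob w u)"
      by (intro sum.cong) (auto simp: averaged_prob_def[symmetric])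
    also have "\<dots> = 1"
      unfolding averaged_prob_def by (subst sum.swap) (simp add: sum_distrib_left[symmetric]
          sum_channel_prob sum_input_prob)
    finally show ?thesis by simp
  qed
  then have "(\<Sum>u\<in>UNIV. input_prob u * (\<Sum>v\<in>UNIV. input_prob v * (\<Sum>x\<in>UNIV. input_prob x *
      (\<Sum>w\<in>UNIV. channel_prob w (u \<or> v) * likelihood_ratio u x w))))
    \<le> (\<Sum>u\<in>UNIV. input_prob u * 1)"
    by (intro sum_mono mult_left_mono less_imp_le[OF input_prob_pos])
  then show ?thesis
    by (simp only: sum_distrib_left mult.assoc mult_1_right sum_input_prob)
qed

end

subsection \<open>The threshold decoder\<close>

context boolean_mac
begin

text \<open>The relation is not symmetric: \<open>i\<close> is the user whose codeword is
  conditioned on.\<close>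

definition accepts :: "real \<Rightarrow> nat \<Rightarrow> (nat \<times> nat \<Rightarrow> bool) \<Rightarrow> (nat \<Rightarrow> bool) \<Rightarrow> nat \<Rightarrow> nat \<Rightarrow> bool" where
  "accepts \<theta> T X y i j \<longleftrightarrow> exp (\<theta> * T) \<le> (\<Prod>t\<in>{1..T}. likelihood_ratio (X (i, t)) (X (j, t)) (y t))"

text \<open>Only edges leaving \<open>i\<close> or \<open>j\<close> towards third users are
  excluded, so a union bound over \<open>2 * (N - 2)\<close> false acceptances suffices.\<close>

definition isolated_pair ::
    "real \<Rightarrow> nat \<Rightarrow> nat \<Rightarrow> (nat \<times> nat \<Rightarrow> bool) \<Rightarrow> (nat \<Rightarrow> bool) \<Rightarrow> nat \<Rightarrow> nat \<Rightarrow> bool" where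
  "isolated_pair \<theta> N T X y i j \<longleftrightarrow> i \<in> {1..N} \<and> j \<in> {1..N} \<and> i < j \<and> accepts \<theta> T X y i j \<and>
     (\<forall>k\<in>{1..N} - {i, j}. \<not> accepts \<theta> T X y i k \<and> \<not> accepts \<theta> T X y j k)"

text \<open>Larger ends of isolated pairs form class 2. The last branch is an arbitrary partition,
  so that both classes always occur.\<close>

definition threshold_decoder ::
    "real \<Rightarrow> nat \<Rightarrow> nat \<Rightarrow> (nat \<times> nat \<Rightarrow> bool) \<Rightarrow> (nat \<Rightarrow> bool) \<Rightarrow> (nat \<Rightarrow> nat)" where
  "threshold_decoder \<theta> N T X y =
     (if \<exists>i j. isolated_pair \<theta> N T X y i j
      then (\<lambda>v\<in>{1..N}. if \<exists>i. isolated_pair \<theta> N T X y i v then 2 else 1)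
      else (\<lambda>v\<in>{1..N}. if v = 1 then 1 else 2))"

text \<open>If \<open>a\<close> were also the larger end of a pair \<open>(i, a)\<close>, then
  \<open>b\<close> would be a third user for that pair, since \<open>i < a < b\<close>, and
  \<open>a\<close> accepting \<open>b\<close> would contradict its isolation. Hence the colouring by
  larger ends separates every isolated pair.\<close>

lemma isolated_pair_not_snd:
  assumes "isolated_pair \<theta> N T X y a b"
  shows "\<not> isolated_pair \<theta> N T X y i a"
proof
  assume "isolated_pair \<theta> N T X y i a"
  then have "b \<notin> {1..N} - {i, a} \<or> \<not> accepts \<theta> T X y a b" "i < a"
    unfolding isolated_pair_def by blast+
  then show False
    using assms by (auto simp: isolated_pair_def)
qed

lemma threshold_decoder_isolated_pair:
  assumes "isolated_pair \<theta> N T X y a b"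
  shows "threshold_decoder \<theta> N T X y a = 1" "threshold_decoder \<theta> N T X y b = 2"
proof -
  have "a \<in> {1..N}" "b \<in> {1..N}"
    using assms by (simp_all add: isolated_pair_def)
  then show "threshold_decoder \<theta> N T X y a = 1" "threshold_decoder \<theta> N T X y b = 2"
    using assms isolated_pair_not_snd[OF assms] by (auto simp: threshold_decoder_def)
qed

lemma threshold_decoder_partition:
  assumes "N \<ge> 2"
  shows "threshold_decoder \<theta> N T X y \<in> partitions N"
proof (cases "\<exists>i j. isolated_pair \<theta> N T X y i j")
  case True
  then obtain a b where ab: "isolated_pair \<theta> N T X y a b"
    by blast
  then have "a \<in> {1..N}" "b \<in> {1..N}"
    by (simp_all add: isolated_pair_def)
  then have "{1, 2} \<subseteq> threshold_decoder \<theta> N T X y ` {1..N}"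
    using threshold_decoder_isolated_pair[OF ab] by (metis empty_subsetI image_eqI insert_subset)
  moreover have "threshold_decoder \<theta> N T X y \<in> {1..N} \<rightarrow>\<^sub>E {1, 2}"
    by (auto simp: threshold_decoder_def)
  ultimately show ?thesis
    by (auto simp: partitions_def PiE_iff)
next
  case False
  have "(2::nat) \<in> (\<lambda>v. if v = 1 then 1 else 2) ` {1..N}" "(1::nat) \<in> (\<lambda>v. if v = 1 then 1 else 2) ` {1..N}"
    using assms by (auto intro: image_eqI[of _ _ 1] image_eqI[of _ _ 2])
  then show ?thesis
    using False by (auto simp: threshold_decoder_def partitions_def)
qed

section \<open>Error probability of the threshold decoder\<close>

lemma false_accept_bound:
  assumes "a \<in> {1..N}" "b \<in> {1..N}" "k \<in> {1..N}" "a \<noteq> b" "k \<noteq> a" "k \<noteq> b"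
  shows "(\<integral>\<^sup>+X. \<integral>\<^sup>+y. indicator {(X, y). accepts \<theta> T X y a k} (X, y)
      \<partial>noise_pmf T q10 q01 (\<lambda>t. X (a, t) \<or> X (b, t)) \<partial>matrix_pmf N T p) \<le> ennreal (exp (- \<theta> * T))"
proof -
  \<comment> \<open>Markov's inequality, in pointwise form, for the likelihood ratio of the whole
    block.\<close>
  have le: "indicator {(X, y). accepts \<theta> T X y a k} (X, y)
    \<le> ennreal (exp (- \<theta> * T)) * (\<Prod>t\<in>{1..T}. ennreal (likelihood_ratio (X (a, t)) (X (k, t)) (y t)))" for X y
  proof (cases "accepts \<theta> T X y a k")
    case True
    then have "1 \<le> exp (- \<theta> * T) * (\<Prod>t\<in>{1..T}. likelihood_ratio (X (a, t)) (X (k, t)) (y t))"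
      by (simp add: accepts_def exp_minus field_simps)
    then show ?thesis
      using True by (simp add: prod_ennreal likelihood_ratio_nonneg prod_nonneg flip: ennreal_mult)
  qed simp
  let ?G = "\<lambda>u v x. \<Sum>w\<in>UNIV. channel_prob w (u \<or> v) * likelihood_ratio u x w"
  have noise: "(\<integral>\<^sup>+y. (\<Prod>t\<in>{1..T}. ennreal (likelihood_ratio (X (a, t)) (X (k, t)) (y t)))
        \<partial>noise_pmf T q10 q01 (\<lambda>t. X (a, t) \<or> X (b, t)))
      = (\<Prod>t\<in>{1..T}. ennreal (?G (X (a, t)) (X (b, t)) (X (k, t))))" for X
    unfolding channel_prob_def
    by (rule nn_integral_noise[where F = "\<lambda>t. likelihood_ratio (X (a, t)) (X (k, t))"]) (rule likelihood_ratio_nonneg)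
  have G: "?G u v x \<ge> 0" for u v x
    by (intro sum_nonneg mult_nonneg_nonneg channel_prob_nonneg likelihood_ratio_nonneg)
  have "(\<integral>\<^sup>+X. \<integral>\<^sup>+y. indicator {(X, y). accepts \<theta> T X y a k} (X, y)
      \<partial>noise_pmf T q10 q01 (\<lambda>t. X (a, t) \<or> X (b, t)) \<partial>matrix_pmf N T p)
    \<le> (\<integral>\<^sup>+X. \<integral>\<^sup>+y. ennreal (exp (- \<theta> * T)) * (\<Prod>t\<in>{1..T}. ennreal (likelihood_ratio (X (a, t)) (X (k, t)) (y t)))
      \<partial>noise_pmf T q10 q01 (\<lambda>t. X (a, t) \<or> X (b, t)) \<partial>matrix_pmf N T p)"
    by (intro nn_integral_mono le)
  also have "\<dots> = ennreal (exp (- \<theta> * T)) *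
      (\<integral>\<^sup>+X. (\<Prod>t\<in>{1..T}. ennreal (?G (X (a, t)) (X (b, t)) (X (k, t)))) \<partial>matrix_pmf N T p)"
    by (simp add: noise nn_integral_cmult del: One_nat_def)
  also have "\<dots> \<le> ennreal (exp (- \<theta> * T)) * 1"
    \<comment> \<open>Row \<open>k\<close> is independent of the output, so each round contributes a
      mean of at most 1.\<close>
    unfolding nn_integral_matrix_three_rows[OF assms, of ?G, OF G] input_prob_def[symmetric]
    using sum_likelihood_ratio_le by (intro mult_left_mono power_le_one) simp_all
  finally show ?thesis by simp
qed

text \<open>Chernoff's method: Markov's inequality for the power \<open>- \<sigma>\<close> of the
  block likelihood ratio, whose mean factors over the rounds.\<close>

lemma missed_detection_bound:
  assumes "a \<in> {1..N}" "b \<in> {1..N}" "a \<noteq> b" "\<sigma> > 0"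
  shows "(\<integral>\<^sup>+X. \<integral>\<^sup>+y. indicator {(X, y). \<not> accepts \<theta> T X y a b} (X, y)
      \<partial>noise_pmf T q10 q01 (\<lambda>t. X (a, t) \<or> X (b, t)) \<partial>matrix_pmf N T p)
    \<le> ennreal ((exp (\<theta> * \<sigma>) *
        (\<Sum>u\<in>UNIV. \<Sum>v\<in>UNIV. \<Sum>w\<in>UNIV. joint_prob u v w * likelihood_ratio u v w powr (- \<sigma>))) ^ T)"
proof -
  let ?noise = "\<lambda>X. noise_pmf T q10 q01 (\<lambda>t. X (a, t) \<or> X (b, t))"
  have le: "indicator {(X, y). \<not> accepts \<theta> T X y a b} (X, y)
    \<le> ennreal (exp (\<theta> * \<sigma>) ^ T) * (\<Prod>t\<in>{1..T}. ennreal (likelihood_ratio (X (a, t)) (X (b, t)) (y t) powr (- \<sigma>)))"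
    if "y \<in> set_pmf (?noise X)" for X y
  proof (cases "accepts \<theta> T X y a b")
    case False
    let ?L = "\<Prod>t\<in>{1..T}. likelihood_ratio (X (a, t)) (X (b, t)) (y t)"
    \<comment> \<open>A vanishing likelihood ratio would break the pointwise bound, since
      \<open>0 powr (- \<sigma>) = 0\<close>. It does not occur for outputs in the support of the
      noise.\<close>
    have pos: "likelihood_ratio (X (a, t)) (X (b, t)) (y t) > 0" if "t \<in> {1..T}" for t
    proof -
      have "pmf (?noise X) y \<noteq> 0"
        using \<open>y \<in> set_pmf (?noise X)\<close> by (simp add: set_pmf_iff)
      then have "channel_prob (y t) (X (a, t) \<or> X (b, t)) \<noteq> 0"
        using that by (auto simp: noise_pmf_def pmf_Pi channel_prob_def split: if_splits)
      then show ?thesis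
        using likelihood_ratio_pos channel_prob_nonneg by (simp add: order_less_le)
    qed
    then have "?L > 0"
      by (intro prod_pos) auto
    moreover have "?L < exp (\<theta> * T)"
      using False by (simp add: accepts_def)
    ultimately have "exp (\<theta> * T) powr (- \<sigma>) \<le> ?L powr (- \<sigma>)"
      using assms by (intro powr_mono2') auto
    then have "exp (\<theta> * \<sigma>) ^ T * exp (\<theta> * T) powr (- \<sigma>) \<le> exp (\<theta> * \<sigma>) ^ T * ?L powr (- \<sigma>)"
      by (intro mult_left_mono) auto
    moreover have "exp (\<theta> * \<sigma>) ^ T * exp (\<theta> * T) powr (- \<sigma>) = 1"
      by (simp add: powr_def exp_of_nat_mult[symmetric] exp_minus mult_ac)
    moreover have "?L powr (- \<sigma>) = (\<Prod>t\<in>{1..T}. likelihood_ratio (X (a, t)) (X (b, t)) (y t) powr (- \<sigma>))"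
      by (rule prod_powr_distrib)
    ultimately show ?thesis
      using False by (simp add: prod_ennreal prod_nonneg flip: ennreal_mult)
  qed simp
  let ?G = "\<lambda>u v. \<Sum>w\<in>UNIV. channel_prob w (u \<or> v) * likelihood_ratio u v w powr (- \<sigma>)"
  have noise: "(\<integral>\<^sup>+y. (\<Prod>t\<in>{1..T}. ennreal (likelihood_ratio (X (a, t)) (X (b, t)) (y t) powr (- \<sigma>))) \<partial>?noise X)
      = (\<Prod>t\<in>{1..T}. ennreal (?G (X (a, t)) (X (b, t))))" for X
    unfolding channel_prob_def
    by (rule nn_integral_noise[where F = "\<lambda>t w. likelihood_ratio (X (a, t)) (X (b, t)) w powr (- \<sigma>)"]) simp
  have G: "?G u v \<ge> 0" for u v
    by (intro sum_nonneg mult_nonneg_nonneg channel_prob_nonneg) simp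
  let ?Z = "\<Sum>u\<in>UNIV. \<Sum>v\<in>UNIV. \<Sum>w\<in>UNIV. joint_prob u v w * likelihood_ratio u v w powr (- \<sigma>)"
  have Z: "(\<Sum>u\<in>UNIV. \<Sum>v\<in>UNIV. input_prob u * input_prob v * ?G u v) = ?Z"
    by (simp add: joint_prob_def sum_distrib_left mult.assoc)
  have Z0: "?Z \<ge> 0"
    by (intro sum_nonneg mult_nonneg_nonneg joint_prob_nonneg) simp
  have "(\<integral>\<^sup>+X. \<integral>\<^sup>+y. indicator {(X, y). \<not> accepts \<theta> T X y a b} (X, y) \<partial>?noise X \<partial>matrix_pmf N T p)
    \<le> (\<integral>\<^sup>+X. \<integral>\<^sup>+y. ennreal (exp (\<theta> * \<sigma>) ^ T) *
          (\<Prod>t\<in>{1..T}. ennreal (likelihood_ratio (X (a, t)) (X (b, t)) (y t) powr (- \<sigma>)))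
        \<partial>?noise X \<partial>matrix_pmf N T p)"
    by (intro nn_integral_mono nn_integral_mono_AE) (use le in \<open>auto simp: AE_measure_pmf_iff\<close>)
  also have "\<dots> = ennreal (exp (\<theta> * \<sigma>) ^ T) *
      (\<integral>\<^sup>+X. (\<Prod>t\<in>{1..T}. ennreal (?G (X (a, t)) (X (b, t)))) \<partial>matrix_pmf N T p)"
    by (simp add: noise nn_integral_cmult del: One_nat_def)
  also have "\<dots> = ennreal ((exp (\<theta> * \<sigma>) *
        (\<Sum>u\<in>UNIV. \<Sum>v\<in>UNIV. \<Sum>w\<in>UNIV. joint_prob u v w * likelihood_ratio u v w powr (- \<sigma>))) ^ T)"
    unfolding nn_integral_matrix_two_rows[OF assms(1-3), of ?G, OF G] input_prob_def[symmetric] Z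
    using Z0 by (simp add: ennreal_power power_mult_distrib flip: ennreal_mult)
  finally show ?thesis .
qed

lemma threshold_decoder_error_le:
  assumes "N \<ge> 2" "\<sigma> > 0"
    and c: "c = exp (\<theta> * \<sigma>) *
      (\<Sum>u\<in>UNIV. \<Sum>v\<in>UNIV. \<Sum>w\<in>UNIV. joint_prob u v w * likelihood_ratio u v w powr (- \<sigma>))"
  shows "avg_error_prob N T p q10 q01 (threshold_decoder \<theta> N T) \<le> c ^ T + 2 * N * exp (- \<theta> * T)"
proof -
  let ?h = "threshold_decoder \<theta> N T" and ?S = "active_vectors N" and ?B = "c ^ T + 2 * N * exp (- \<theta> * T)"
  let ?noise = "\<lambda>X s. noise_pmf T q10 q01 (noiseless_output N X s)"
  let ?err = "{(X, s, y). distortion N s (?h X y) \<noteq> 0}"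
  note S = active_vectors_nonempty[OF assms(1)] finite_active_vectors
  have c0: "c \<ge> 0"
    unfolding c by (intro mult_nonneg_nonneg sum_nonneg joint_prob_nonneg) auto
  have bound: "(\<integral>\<^sup>+X. \<integral>\<^sup>+y. indicator ?err (X, s, y) \<partial>?noise X s \<partial>matrix_pmf N T p) \<le> ennreal ?B"
    if "s \<in> ?S" for s
  proof -
    from that obtain a b where ab: "a \<in> {1..N}" "b \<in> {1..N}" "a < b" and s: "s = (\<lambda>i. i = a \<or> i = b)"
      by (rule active_vectorE)
    let ?n = "\<lambda>X. noise_pmf T q10 q01 (\<lambda>t. X (a, t) \<or> X (b, t))"
    let ?K = "{1..N} - {a, b}"
    let ?A = "\<lambda>i k. {(X, y). accepts \<theta> T X y i k}" and ?A' = "{(X, y). \<not> accepts \<theta> T X y a b}"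
    \<comment> \<open>If the active pair is isolated, the decoder separates it. Otherwise it was
      missed, or one of its ends accepts an inactive user; the union bound adds these
      events.\<close>
    have le: "indicator ?err (X, s, y)
      \<le> (indicator ?A' (X, y) + (\<Sum>k\<in>?K. indicator (?A a k) (X, y) + indicator (?A b k) (X, y)) :: ennreal)"
      for X y
    proof (cases "isolated_pair \<theta> N T X y a b")
      case True
      then show ?thesis
        using threshold_decoder_isolated_pair[OF True] distortion_pair[OF ab, of "?h X y"] by (simp add: s)
    next
      case False
      then consider "\<not> accepts \<theta> T X y a b" | k where "k \<in> ?K" "accepts \<theta> T X y a k \<or> accepts \<theta> T X y b k"
        using ab unfolding isolated_pair_def by blast
      then show ?thesis
      proof cases
        case 1
        then show ?thesis by (simp add: indicator_def)
      next
        case 2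
        then have "(1 :: ennreal) \<le> indicator (?A a k) (X, y) + indicator (?A b k) (X, y)"
          by (auto simp: indicator_def)
        also have "\<dots> \<le> (\<Sum>k\<in>?K. indicator (?A a k) (X, y) + indicator (?A b k) (X, y))"
          using 2(1) by (intro member_le_sum[where f = "\<lambda>k. indicator (?A a k) (X, y) + indicator (?A b k) (X, y)"]) auto
        finally show ?thesis
          by (auto simp: indicator_def intro: order_trans add_increasing)
      qed
    qed
    have "(\<integral>\<^sup>+X. \<integral>\<^sup>+y. indicator ?err (X, s, y) \<partial>?noise X s \<partial>matrix_pmf N T p)
      \<le> (\<integral>\<^sup>+X. \<integral>\<^sup>+y. indicator ?A' (X, y) + (\<Sum>k\<in>?K. indicator (?A a k) (X, y) + indicator (?A b k) (X, y))
          \<partial>?n X \<partial>matrix_pmf N T p)"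
      unfolding s noiseless_output_pair[OF ab(1,2)] by (intro nn_integral_mono le[unfolded s])
    also have "\<dots> = (\<integral>\<^sup>+X. \<integral>\<^sup>+y. indicator ?A' (X, y) \<partial>?n X \<partial>matrix_pmf N T p)
      + (\<Sum>k\<in>?K. (\<integral>\<^sup>+X. \<integral>\<^sup>+y. indicator (?A a k) (X, y) \<partial>?n X \<partial>matrix_pmf N T p)
          + (\<integral>\<^sup>+X. \<integral>\<^sup>+y. indicator (?A b k) (X, y) \<partial>?n X \<partial>matrix_pmf N T p))"
      by (simp add: nn_integral_add nn_integral_sum del: nn_integral_indicator)
    also have "\<dots> \<le> ennreal (c ^ T) + (\<Sum>k\<in>?K. ennreal (exp (- \<theta> * T)) + ennreal (exp (- \<theta> * T)))"
    proof (intro add_mono sum_mono)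
      fix k assume k: "k \<in> ?K"
      show "(\<integral>\<^sup>+X. \<integral>\<^sup>+y. indicator (?A a k) (X, y) \<partial>?n X \<partial>matrix_pmf N T p) \<le> ennreal (exp (- \<theta> * T))"
        using ab k by (intro false_accept_bound) auto
      \<comment> \<open>The same bound seen from \<open>b\<close>: the channel output is symmetric
        in the two active users.\<close>
      have "(\<integral>\<^sup>+X. \<integral>\<^sup>+y. indicator (?A b k) (X, y) \<partial>noise_pmf T q10 q01 (\<lambda>t. X (b, t) \<or> X (a, t)) \<partial>matrix_pmf N T p)
          \<le> ennreal (exp (- \<theta> * T))"
        using ab k by (intro false_accept_bound) auto
      then show "(\<integral>\<^sup>+X. \<integral>\<^sup>+y. indicator (?A b k) (X, y) \<partial>?n X \<partial>matrix_pmf N T p) \<le> ennreal (exp (- \<theta> * T))"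
        by (simp only: disj_commute)
    qed (use ab assms(2) c in \<open>auto intro!: missed_detection_bound\<close>)
    also have "\<dots> = ennreal (c ^ T + card ?K * (2 * exp (- \<theta> * T)))"
      using c0 by (simp add: ennreal_of_nat_eq_real_of_nat flip: ennreal_plus ennreal_mult)
    also have "\<dots> \<le> ennreal ?B"
    proof (rule ennreal_leI)
      have "card ?K \<le> N"
        using card_mono[of "{1..N}" ?K] by auto
      then have "card ?K * (2 * exp (- \<theta> * T)) \<le> N * (2 * exp (- \<theta> * T))"
        by (intro mult_right_mono) auto
      then show "c ^ T + card ?K * (2 * exp (- \<theta> * T)) \<le> ?B"
        by simp
    qed
    finally show ?thesis .
  qed
  have "ennreal (avg_error_prob N T p q10 q01 ?h) = emeasure (system_pmf N T p q10 q01) ?err"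
    unfolding avg_error_prob_def by (simp add: measure_pmf.emeasure_eq_measure)
  \<comment> \<open>Drawing \<open>s\<close> before \<open>X\<close> allows the bound to be applied
    for each fixed active pair.\<close>
  also have "\<dots> = (\<integral>\<^sup>+s. \<integral>\<^sup>+X. \<integral>\<^sup>+y. indicator ?err (X, s, y) \<partial>?noise X s \<partial>matrix_pmf N T p \<partial>pmf_of_set ?S)"
    unfolding system_pmf_def
    by (subst bind_commute_pmf) (simp add: emeasure_bind_pmf nn_integral_indicator[symmetric] 
        flip: measure_pmf.emeasure_eq_measure)
  also have "\<dots> \<le> (\<integral>\<^sup>+s. ennreal ?B \<partial>pmf_of_set ?S)"
    using S bound by (intro nn_integral_mono_AE) (auto simp: AE_measure_pmf_iff)
  also have "\<dots> = ennreal ?B"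
    by simp
  finally show ?thesis
    using c0 by (subst (asm) ennreal_le_iff) auto
qed

end

subsection \<open>Achievability\<close>

text \<open>At \<open>p = 0\<close> the quotient is 1 and \<open>ln (rho_plus l 0) = l\<close>, so
  the exponents vanish; for \<open>q10\<close> equal to 0 or 1 one quotient is \<open>0 / 0\<close>,
  but its weight is 0. This makes the maximal cut rate nonnegative.\<close>

lemma cut_rate_0_left: "cut_rate 0 q10 q01 = 0"
proof -
  have "rho_plus l 0 = exp l" for l
    by (simp add: rho_plus_def)
  then show ?thesis
    by (cases "q10 = 0"; cases "q10 = 1") (simp_all add: cut_rate_def phi0_def phi1_def prob0_def prob1_def)
qed

lemma cut_rate_1_left: "cut_rate 1 q10 q01 = 0"
  by (simp add: cut_rate_def phi0_def phi1_def rho_plus_def)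

theorem theorem1:
  fixes q10 q01 p \<xi> :: real
    and T :: "nat \<Rightarrow> nat"
    and g :: "nat \<Rightarrow> (nat \<times> nat \<Rightarrow> bool) \<Rightarrow> (nat \<Rightarrow> bool) \<Rightarrow> (nat \<Rightarrow> nat)"
  assumes "q10 \<in> {0..1}" and "q01 \<in> {0..1}"
    and "p \<in> {0..1}" and "\<forall>p'\<in>{0..1}. cut_rate p' q10 q01 \<le> cut_rate p q10 q01"
    and "\<xi> > 0"
    and "\<forall>\<^sub>F N in sequentially. ereal (real (T N) / ln (real N)) \<ge> C1 q10 q01 + ereal \<xi>"
    and "\<forall>N\<ge>2. bayes_decoder N (T N) q10 q01 (g N)"
  shows "(\<lambda>N. avg_error_prob N (T N) p q10 q01 (g N)) \<longlonglongrightarrow> 0"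
proof -
  define C where "C = cut_rate p q10 q01"
  have "(SUP p\<in>{0..1}. cut_rate p q10 q01) = C"
    unfolding C_def using assms(3,4) by (intro cSup_eq_maximum) auto
  then have C1: "C1 q10 q01 = 1 / ereal C"
    by (simp add: C1_def)
  have "C \<ge> 0"
    using bspec[OF assms(4), of 0] cut_rate_0_left[of q10 q01] by (simp add: C_def)
  \<comment> \<open>For \<open>C = 0\<close> the threshold \<open>C1\<close> is infinite, and no
    real ratio of \<open>T N\<close> to \<open>ln N\<close> reaches it.\<close>
  have "C \<noteq> 0"
  proof
    assume "C = 0"
    then have "\<forall>\<^sub>F N::nat in sequentially. False"
      using assms(6) by (simp add: C1 divide_ereal_def)
    then show False by simp
  qed
  with \<open>C \<ge> 0\<close> have C: "C > 0" by simp
  then have "p \<noteq> 0" "p \<noteq> 1"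
    using cut_rate_0_left[of q10 q01] cut_rate_1_left[of q10 q01] by (auto simp: C_def)
  then interpret boolean_mac p q10 q01
    using assms(1-3) by unfold_locales auto
  define \<beta> where "\<beta> = 1 / C + \<xi>"
  have \<beta>: "\<beta> > 0" "1 / \<beta> < C"
    using C assms(5) by (auto simp: \<beta>_def field_simps add_pos_pos)
  \<comment> \<open>The midpoint of \<open>1 / \<beta>\<close> and \<open>C\<close>: above the
    former, \<open>N * exp (- \<theta> * T)\<close> vanishes; below the latter, and hence below
    \<open>mutual_info\<close>, a Chernoff exponent exists.\<close>
  define \<theta> where "\<theta> = (1 / \<beta> + C) / 2"
  have "1 / \<beta> < \<theta>" "\<theta> < C"
    using \<beta> by (auto simp: \<theta>_def)
  then have \<theta>: "\<theta> > 0" "\<theta> * \<beta> > 1" "\<theta> < mutual_info"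
    using \<beta> cut_rate_le_mutual_info by (auto simp: C_def field_simps intro: less_trans[of 0 "1 / \<beta>"])
  obtain \<sigma> where \<sigma>: "\<sigma> > 0"
    "exp (\<theta> * \<sigma>) * (\<Sum>u\<in>UNIV. \<Sum>v\<in>UNIV. \<Sum>w\<in>UNIV. joint_prob u v w * likelihood_ratio u v w powr (- \<sigma>)) < 1"
    using exists_chernoff_exponent[OF \<theta>(3)] .
  define c where "c = exp (\<theta> * \<sigma>) *
    (\<Sum>u\<in>UNIV. \<Sum>v\<in>UNIV. \<Sum>w\<in>UNIV. joint_prob u v w * likelihood_ratio u v w powr (- \<sigma>))"
  have c: "0 \<le> c" "c < 1"
    using \<sigma>(2) by (auto simp: c_def intro!: sum_nonneg mult_nonneg_nonneg joint_prob_nonneg)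
  have large: "\<forall>\<^sub>F N in sequentially. N \<ge> 2 \<and> real (T N) \<ge> \<beta> * ln (real N)"
    using assms(6) eventually_ge_at_top[of 2]
  proof eventually_elim
    case (elim N)
    then have "\<beta> \<le> real (T N) / ln (real N)"
      using C by (simp add: C1 \<beta>_def one_ereal_def)
    moreover have "ln (real N) > 0"
      using elim by simp
    ultimately show ?case
      using elim by (simp add: pos_le_divide_eq)
  qed
  have "filterlim (\<lambda>N. \<beta> * ln (real N)) at_top sequentially"
    using \<beta> by (intro filterlim_tendsto_pos_mult_at_top[OF tendsto_const]
        filterlim_compose[OF ln_at_top] filterlim_real_sequentially)
  then have "filterlim (\<lambda>N. real (T N)) at_top sequentially"
    by (rule filterlim_at_top_mono) (use large in eventually_elim, auto)
  then have "filterlim T at_top sequentially"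
    by (simp add: filterlim_sequentially_iff_filterlim_real)
  then have lim1: "(\<lambda>N. c ^ T N) \<longlonglongrightarrow> 0"
    using c by (intro filterlim_compose[OF LIMSEQ_power_zero]) auto
  have "filterlim (\<lambda>N. (1 - \<theta> * \<beta>) * ln (real N)) at_bot sequentially"
    using \<theta> by (intro filterlim_tendsto_neg_mult_at_bot[OF tendsto_const]
        filterlim_compose[OF ln_at_top] filterlim_real_sequentially) auto
  then have lim2: "(\<lambda>N. 2 * exp ((1 - \<theta> * \<beta>) * ln (real N))) \<longlonglongrightarrow> 0"
    by (intro tendsto_mult_right_zero filterlim_compose[OF exp_at_bot])
  have upper: "\<forall>\<^sub>F N in sequentially. avg_error_prob N (T N) p q10 q01 (g N)
      \<le> c ^ T N + 2 * exp ((1 - \<theta> * \<beta>) * ln (real N))"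
    using large
  proof eventually_elim
    case (elim N)
    have "avg_error_prob N (T N) p q10 q01 (g N)
        \<le> avg_error_prob N (T N) p q10 q01 (threshold_decoder \<theta> N (T N))"
      using elim assms(7) by (intro bayes_decoder_optimal threshold_decoder_partition) auto
    also have "\<dots> \<le> c ^ T N + 2 * real N * exp (- \<theta> * T N)"
      using elim \<sigma>(1) by (intro threshold_decoder_error_le[OF _ _ c_def]) auto
    finally have "avg_error_prob N (T N) p q10 q01 (g N) \<le> c ^ T N + 2 * real N * exp (- \<theta> * T N)" .
    moreover have "2 * real N * exp (- \<theta> * T N) \<le> 2 * real N * exp (- \<theta> * (\<beta> * ln N))"
      using elim \<theta>(1) by (intro mult_left_mono) auto
    \<comment> \<open>The false acceptances contribute at most 2 times \<open>N\<close> to the power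
      \<open>1 - \<theta> * \<beta>\<close>, which is negative.\<close>
    moreover have "2 * real N * exp (- \<theta> * (\<beta> * ln N)) = 2 * exp ((1 - \<theta> * \<beta>) * ln (real N))"
    proof -
      have "(1 - \<theta> * \<beta>) * ln (real N) = ln (real N) + - \<theta> * (\<beta> * ln N)"
        by (simp add: algebra_simps)
      then show ?thesis
        using elim by (simp only: exp_add) simp
    qed
    ultimately show ?case by linarith
  qed
  have lim: "(\<lambda>N. c ^ T N + 2 * exp ((1 - \<theta> * \<beta>) * ln (real N))) \<longlonglongrightarrow> 0"
    using tendsto_add[OF lim1 lim2] by simp
  show ?thesis
    by (rule tendsto_sandwich[OF _ upper tendsto_const lim]) (simp add: avg_error_prob_def)
qed

end
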